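(* Let $r\ge1$, $(k_1,\dots,k_r)\in\mathbb{Z}_{\ge1}^r$ and $t\in\mathbb{Z}_{\ge0}$. Then \[ \sum_{\substack{m_1+\cdots+m_r=r+t\\ m_i\ge1\,(1\le i\le r)}}\ \sum_{\substack{\mathbf{a}_i\in\mathbb{Z}_{\ge1}^{m_i},\ |\mathbf{a}_i|=k_i+m_i-1\\(1\le i\le r)}}\zeta^+(\mathbf{a}_1,\dots,\mathbf{a}_r) =\sum_{l=0}^{t}\ \sum_{\substack{m_1+\cdots+m_{r-1}=t-l\\ m_i\ge0\,(1\le i\le r-1)}}\ \sum_{\substack{|\mathbf{e}|=l\\ \mathbf{e}\ge0}}\zeta^+\big((k_1,\{1\}^{m_1},\dots,k_{r-1},\{1\}^{m_{r-1}},k_r)+\mathbf{e}\big), \] where $(\mathbf{a}_1,\dots,\mathbf{a}_r)$ denotes the concatenation of the tuples, and in the last sum $\mathbf{e}$ ranges over tuples of non-negative integers of the same depth as $(k_1,\{1\}^{m_1},\dots,k_{r-1},\{1\}^{m_{r-1}},k_r)$ with sum $l$. When $r=1$, the right-hand side is understood as $\zeta^+(k_1+t)$.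
   Context: For positive integers $k_1,\dots,k_r$ with $k_1\ge2$, the multiple zeta value is $\zeta(k_1,\dots,k_r)=\sum_{n_1>\cdots>n_r\ge1}n_1^{-k_1}\cdots n_r^{-k_r}$. For $(k_1,\dots,k_r)\in\mathbb{Z}_{\ge1}^r$ set $\zeta^+(k_1,\dots,k_r):=\zeta(k_1+1,k_2,\dots,k_r)$. An index is a finite tuple of positive integers; for an index $\mathbf{k}=(k_1,\dots,k_r)$, its weight is $|\mathbf{k}|=k_1+\cdots+k_r$ and its depth is $r$. For two tuples of the same depth, $\mathbf{k}+\mathbf{e}$ denotes componentwise addition; $\mathbf{e}\ge0$ means every component of $\mathbf{e}$ is a non-negative integer, and $|\mathbf{e}|$ is the sum of its components. $\{1\}^m$ denotes $m$ consecutive entries equal to $1$ (empty if $m=0$). *)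

theory Defs
  imports "HOL-Analysis.Analysis"
begin

text \<open>Indices are lists of natural numbers, with the positivity of the entries stated where it
  is required. The component \<open>k\<^sub>i\<close> of an index \<open>ks\<close> is \<open>ks ! (i - 1)\<close>.\<close>

definition mzv_domain :: "nat \<Rightarrow> nat list set" where
  "mzv_domain r = {ns. length ns = r \<and> sorted_wrt (>) ns \<and> (\<forall>n\<in>set ns. 1 \<le> n)}"

text \<open>Meaningful for indices with first entry at least 2. All terms are nonnegative, so the
  unordered infinite sum agrees with every iterated or truncated reading of the series.\<close>

definition mzv :: "nat list \<Rightarrow> real" where
  "mzv ks = (\<Sum>\<^sub>\<infinity>ns\<in>mzv_domain (length ks). \<Prod>i<length ks. 1 / real (ns ! i) ^ (ks ! i))"

definition mzv_plus :: "nat list \<Rightarrow> real" where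
  "mzv_plus ks = mzv ((hd ks + 1) # tl ks)"

definition compositions :: "nat \<Rightarrow> nat \<Rightarrow> nat list set" where
  "compositions m w = {as. length as = m \<and> (\<forall>a\<in>set as. 1 \<le> a) \<and> sum_list as = w}"

definition weak_compositions :: "nat \<Rightarrow> nat \<Rightarrow> nat list set" where
  "weak_compositions m w = {es. length es = m \<and> sum_list es = w}"

definition block_families :: "nat list \<Rightarrow> nat list \<Rightarrow> nat list list set" where
  "block_families ks ms =
     {as. length as = length ks \<and>
          (\<forall>i<length ks. as ! i \<in> compositions (ms ! i) (ks ! i + ms ! i - 1))}"

text \<open>For \<open>ks = [k\<^sub>1, \<dots>, k\<^sub>r]\<close> and \<open>ms = [m\<^sub>1, \<dots>, m\<^sub>r\<^sub>-\<^sub>1]\<close>, the index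
  \<open>(k\<^sub>1, {1}\<^bsup>m\<^sub>1\<^esup>, \<dots>, k\<^sub>r\<^sub>-\<^sub>1, {1}\<^bsup>m\<^sub>r\<^sub>-\<^sub>1\<^esup>, k\<^sub>r)\<close>.\<close>

definition insert_ones :: "nat list \<Rightarrow> nat list \<Rightarrow> nat list" where
  "insert_ones ks ms =
     concat (map2 (\<lambda>k m. k # replicate m 1) (butlast ks) ms) @ [last ks]"

lemma finite_weak_compositions: "finite (weak_compositions m w)"
proof (rule finite_subset)
  show "weak_compositions m w \<subseteq> {xs. set xs \<subseteq> {..w} \<and> length xs = m}"
    by (auto simp: weak_compositions_def member_le_sum_list)
qed (simp add: finite_lists_length_eq)

lemma finite_compositions: "finite (compositions m w)"
  by (rule finite_subset[OF _ finite_weak_compositions[of m w]])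
     (auto simp: compositions_def weak_compositions_def)

lemma finite_block_families: "finite (block_families ks ms)"
proof (rule finite_subset)
  let ?A = "\<Union>i<length ks. compositions (ms ! i) (ks ! i + ms ! i - 1)"
  show "block_families ks ms \<subseteq> {as. set as \<subseteq> ?A \<and> length as = length ks}"
    by (fastforce simp: block_families_def in_set_conv_nth)
  show "finite {as. set as \<subseteq> ?A \<and> length as = length ks}"
    by (intro finite_lists_length_eq finite_UN_I finite_compositions) auto
qed

text \<open>In depth one, the general form of the right-hand side reduces to a single value: the empty
  tuple \<open>(m\<^sub>1, \<dots>, m\<^sub>r\<^sub>-\<^sub>1)\<close> has sum 0, which forces \<open>l = t\<close>.\<close>

lemma rhs_depth_one:
  "(\<Sum>l=0..t. \<Sum>ms\<in>weak_compositions (length [k] - 1) (t - l).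
      \<Sum>es\<in>weak_compositions (length (insert_ones [k] ms)) l.
        mzv_plus (map2 (+) (insert_ones [k] ms) es)) = mzv_plus [k + t]"
proof -
  have w0: "weak_compositions 0 n = (if n = 0 then {[]} else {})" for n
    by (auto simp: weak_compositions_def)
  have w1: "weak_compositions (Suc 0) n = {[n]}" for n
    by (auto simp: weak_compositions_def length_Suc_conv)
  have "(\<Sum>l=0..t. \<Sum>ms\<in>weak_compositions 0 (t - l). mzv_plus [k + l])
      = (\<Sum>l=0..t. if l = t then mzv_plus [k + l] else 0)"
    by (intro sum.cong) (auto simp: w0)
  then show ?thesis
    by (simp add: insert_ones_def w1)
qed

end

theory Submission
  imports Defs
begin

text \<open>
  Multiply both sides by \<open>x\<^sup>t\<close> and sum over \<open>t\<close>. In the iterated integral for \<open>\<zeta>\<^sup>+(k\<^sub>1, \<dots>, k\<^sub>r)\<close>,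
  with forms \<open>ds/s\<close> and \<open>ds/(1-s)\<close>, the left-hand side inserts any number of forms \<open>x ds/(1-s)\<close>
  after every letter but the last. Each insertion between \<open>s > s'\<close> contributes the factor
  \<open>((1-s')/(1-s))\<^sup>x\<close>; these telescope to \<open>(1-s')\<^sup>x (1-s)\<^sup>-\<^sup>x\<close> with \<open>s\<close> the outermost and \<open>s'\<close> the
  innermost variable. Expanding in powers of \<open>s\<close> and evaluating the last integral as a Beta
  value gives
  the sum over \<open>n\<^sub>1 > \<dots> > n\<^sub>r \<ge> 1\<close> of \<open>1/n\<^sub>1\<close> times the product of all \<open>n\<^sub>i\<^sup>-\<^sup>k\<^sup>i\<close> times the
  product of \<open>j/(j-x)\<close> over \<open>n\<^sub>r \<le> j \<le> n\<^sub>1\<close>.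
  On the right-hand side, raising an exponent at \<open>n\<close> contributes \<open>n/(n-x)\<close>, and inserting ones
  contributes \<open>1 + x/(n-x) = n/(n-x)\<close> for every other \<open>n\<close> between \<open>n\<^sub>r\<close> and \<open>n\<^sub>1\<close>, so the
  result is the same. Integrals are replaced throughout by formal power series in \<open>s\<close> with the
  operator \<open>s d/ds\<close>. For small \<open>x \<ge> 0\<close> all terms are nonnegative, so sums may be interchanged.
\<close>

unbundle no vec_syntax
unbundle fps_syntax

section \<open>Generating function of the left-hand side\<close>

text \<open>For \<open>x = 0\<close> the base case is the indicator of \<open>n = 0\<close>, and \<open>nested 0 ks n\<close> is the part of the
  multiple zeta series with \<open>n\<^sub>1 = n\<close>. In general it consists of the coefficients of
  \<open>(1 - s)\<^sup>x\<close>, the innermost factor of the integral.\<close>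

primrec nested :: "real \<Rightarrow> nat list \<Rightarrow> nat \<Rightarrow> real" where
  "nested x [] n = pochhammer (- x) n / fact n"
| "nested x (k # ks) n = (\<Sum>m<n. nested x ks m) / real n ^ k"

text \<open>The series of \<open>(1 - s)\<^sup>-\<^sup>x\<close>.\<close>

definition rising :: "real \<Rightarrow> real fps" where
  "rising x = Abs_fps (\<lambda>n. pochhammer x n / fact n)"

definition euler :: "real fps \<Rightarrow> real fps" where
  "euler f = fps_X * fps_deriv f"

text \<open>The series \<open>s/(1-s)\<close>: the form \<open>ds/(1-s)\<close> once
  \<open>d/ds\<close> has been replaced by \<open>s d/ds\<close>.\<close>

definition partial_sums :: "real fps" where
  "partial_sums = Abs_fps (\<lambda>n. if n = 0 then 0 else 1)"

lemma euler_nth: "euler f $ n = real n * f $ n"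
  by (cases n) (simp_all add: euler_def)

lemma euler_mult: "euler (f * g) = euler f * g + f * euler g"
  by (simp add: euler_def algebra_simps)

lemma partial_sums_nth: "(partial_sums * f) $ n = (\<Sum>m<n. f $ m)"
proof -
  have "(f * partial_sums) $ n = (\<Sum>i=0..n. if i < n then f $ i else 0)"
    by (auto simp: fps_mult_nth partial_sums_def intro!: sum.cong)
  also have "\<dots> = (\<Sum>m<n. f $ m)"
    by (intro sum.mono_neutral_cong_right) auto
  finally show ?thesis
    by (simp add: mult.commute)
qed

text \<open>Coefficient form of \<open>s d/ds (1-s)^(-x) = x s/(1-s) (1-s)^(-x)\<close>.\<close>

lemma pochhammer_partial_sum:
  "x * (\<Sum>m<n. pochhammer x m / fact m) = real n * (pochhammer x n / fact n)"
  for x :: real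
proof (induction n)
  case (Suc n)
  have "x * (\<Sum>m<Suc n. pochhammer x m / fact m) = (x + real n) * (pochhammer x n / fact n)"
    using Suc by (simp add: algebra_simps add_divide_distrib)
  then show ?case
    by (simp add: pochhammer_Suc del: of_nat_Suc)
qed simp

lemma euler_rising: "euler (rising x) = fps_const x * (partial_sums * rising x)"
  by (rule fps_ext)
     (simp add: euler_nth partial_sums_nth pochhammer_partial_sum rising_def)

text \<open>The two logarithmic derivatives cancel, so \<open>s d/ds\<close> kills the product and
  only its constant term 1 remains.\<close>

lemma rising_inverse: "rising x * rising (- x) = 1"
proof (rule fps_ext)
  fix n
  have "euler (rising x * rising (- x)) =
      fps_const x * (partial_sums * rising x) * rising (- x)
      + rising x * (fps_const (- x) * (partial_sums * rising (- x)))"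
    by (simp only: euler_mult euler_rising)
  also have "\<dots> = (fps_const x + fps_const (- x)) * (partial_sums * rising x * rising (- x))"
    by (simp only: algebra_simps)
  also have "\<dots> = 0"
    by (simp del: fps_const_neg)
  finally have "real n * (rising x * rising (- x)) $ n = 0"
    by (metis euler_nth fps_zero_nth)
  then show "(rising x * rising (- x)) $ n = 1 $ n"
    by (cases n) (simp_all add: rising_def)
qed

definition nested_fps :: "real \<Rightarrow> nat list \<Rightarrow> real fps" where
  "nested_fps x ks = Abs_fps (nested x ks)"

lemma nested_fps_nth: "nested_fps x ks $ n = nested x ks n"
  by (simp add: nested_fps_def)

lemma nested_Suc: "nested x (Suc k # ks) n = nested x (k # ks) n / real n"
  by simp

lemma nested_Cons_0: "nested x (k # ks) 0 = 0"
  by simp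

text \<open>With \<open>euler_nested_Suc\<close>: \<open>euler\<close> undoes the outermost
  integration, over \<open>ds/(1-s)\<close> if the first exponent is 1 and over \<open>ds/s\<close>
  if it is larger.\<close>

lemma euler_nested_one: "euler (nested_fps x (Suc 0 # ks)) = partial_sums * nested_fps x ks"
proof (rule fps_ext)
  fix n
  show "euler (nested_fps x (Suc 0 # ks)) $ n = (partial_sums * nested_fps x ks) $ n"
    unfolding euler_nth partial_sums_nth nested_fps_nth by (cases "n = 0") simp_all
qed

lemma euler_nested_Suc: "euler (nested_fps x (Suc k # ks)) = nested_fps x (k # ks)"
proof (rule fps_ext)
  fix n
  show "euler (nested_fps x (Suc k # ks)) $ n = nested_fps x (k # ks) $ n"
    unfolding euler_nth nested_fps_nth by (cases "n = 0") simp_all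
qed

text \<open>The outermost factor \<open>(1-s)^(-x)\<close> times the series carrying the innermost
  factor \<open>(1-s)^x\<close>. By \<open>block_coeff_sums\<close> this is the generating function
  of the block sums in x.\<close>

definition block_gf :: "real \<Rightarrow> nat list \<Rightarrow> nat \<Rightarrow> real" where
  "block_gf x ks n = (rising x * nested_fps x ks) $ n"

lemma block_gf_Nil: "block_gf x [] n = (if n = 0 then 1 else 0)"
proof -
  have "nested_fps x [] = rising (- x)"
    by (rule fps_ext) (simp add: nested_fps_nth rising_def)
  then show ?thesis
    by (simp add: block_gf_def rising_inverse)
qed

lemma block_gf_Cons_0: "block_gf x (k # ks) 0 = 0"
  by (simp add: block_gf_def nested_fps_nth)

text \<open>The extra term of the product rule is the inserted form
  \<open>x ds/(1-s)\<close>.\<close>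

lemma euler_rising_mult:
  "euler (rising x * f) = fps_const x * (partial_sums * (rising x * f)) + rising x * euler f"
  by (simp add: euler_mult euler_rising algebra_simps)

lemma block_gf_one:
  "block_gf x (Suc 0 # ks) n =
     ((\<Sum>m<n. block_gf x ks m) + x * (\<Sum>m<n. block_gf x (Suc 0 # ks) m)) / real n"
proof (cases "n = 0")
  case False
  have "real n * block_gf x (Suc 0 # ks) n = euler (rising x * nested_fps x (Suc 0 # ks)) $ n"
    by (simp add: euler_nth block_gf_def)
  also have "\<dots> = (fps_const x * (partial_sums * (rising x * nested_fps x (Suc 0 # ks)))
      + partial_sums * (rising x * nested_fps x ks)) $ n"
    by (simp only: euler_rising_mult euler_nested_one mult_ac)
  also have "\<dots> = x * (\<Sum>m<n. block_gf x (Suc 0 # ks) m) + (\<Sum>m<n. block_gf x ks m)"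
    by (simp add: partial_sums_nth block_gf_def)
  finally show ?thesis
    using False by (simp add: field_simps)
qed (simp add: block_gf_Cons_0)

lemma block_gf_Suc:
  "block_gf x (Suc k # ks) n =
     (block_gf x (k # ks) n + x * (\<Sum>m<n. block_gf x (Suc k # ks) m)) / real n"
proof (cases "n = 0")
  case False
  have "real n * block_gf x (Suc k # ks) n = euler (rising x * nested_fps x (Suc k # ks)) $ n"
    by (simp add: euler_nth block_gf_def)
  also have "\<dots> = (fps_const x * (partial_sums * (rising x * nested_fps x (Suc k # ks)))
      + rising x * nested_fps x (k # ks)) $ n"
    by (simp only: euler_rising_mult euler_nested_Suc)
  also have "\<dots> = x * (\<Sum>m<n. block_gf x (Suc k # ks) m) + block_gf x (k # ks) n"
    by (simp add: partial_sums_nth block_gf_def)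
  finally show ?thesis
    using False by (simp add: field_simps)
qed (simp add: block_gf_Cons_0)

section \<open>Block sums as functionals of an arbitrary function of the index\<close>

text \<open>Here j = m_1 - 1 counts the surplus entries of the first block. A general
  \<open>\<phi>\<close> lets the recursion prepend entries to the index; \<open>block_sum_eq\<close>
  gives the link to the theorem.\<close>

primrec block_sum :: "nat list \<Rightarrow> nat \<Rightarrow> (nat list \<Rightarrow> real) \<Rightarrow> real" where
  "block_sum [] t \<phi> = (if t = 0 then \<phi> [] else 0)"
| "block_sum (k # ks) t \<phi> =
     (\<Sum>j\<le>t. \<Sum>a\<in>compositions (Suc j) (k + j). block_sum ks (t - j) (\<lambda>w. \<phi> (a @ w)))"

lemma compositions_0: "compositions 0 w = (if w = 0 then {[]} else {})"
  by (auto simp: compositions_def)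

lemma compositions_empty: "w < m \<Longrightarrow> compositions m w = {}"
proof -
  have "length as \<le> sum_list as" if "\<forall>a\<in>set as. 1 \<le> a" for as :: "nat list"
    using that by (induction as) auto
  then show "w < m \<Longrightarrow> compositions m w = {}"
    by (force simp: compositions_def)
qed

lemma compositions_Suc_Suc:
  "compositions (Suc j) (Suc w) =
     (#) 1 ` compositions j w \<union> (\<lambda>a. Suc (hd a) # tl a) ` compositions (Suc j) w"
  (is "?L = ?A \<union> ?B")
proof (intro equalityI subsetI)
  fix a assume "a \<in> ?L"
  then obtain b bs where a: "a = b # bs" "length bs = j" "1 \<le> b" "\<forall>c\<in>set bs. 1 \<le> c"
      "b + sum_list bs = Suc w"
    by (auto simp: compositions_def length_Suc_conv)
  show "a \<in> ?A \<union> ?B"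
  proof (cases "b = 1")
    case True
    then have "bs \<in> compositions j w"
      using a by (simp add: compositions_def)
    then show ?thesis
      using a True by blast
  next
    case False
    then have "(b - 1) # bs \<in> compositions (Suc j) w"
      using a by (auto simp: compositions_def)
    then show ?thesis
      using a False by (intro UnI2 rev_image_eqI) auto
  qed
qed (auto simp: compositions_def length_Suc_conv)

lemma sum_compositions_Suc_Suc:
  "(\<Sum>a\<in>compositions (Suc j) (Suc w). \<psi> a) =
     (\<Sum>a\<in>compositions j w. \<psi> (1 # a)) + (\<Sum>a\<in>compositions (Suc j) w. \<psi> (Suc (hd a) # tl a))"
  for \<psi> :: "nat list \<Rightarrow> real"
proof -
  have ne: "a \<noteq> []" "1 \<le> hd a" if "a \<in> compositions (Suc j) w" for a
    using that by (cases a; auto simp: compositions_def)+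
  have inj: "inj_on (\<lambda>a. Suc (hd a) # tl a) (compositions (Suc j) w)"
    by (intro inj_onI) (metis list.expand list.inject nat.inject ne(1))
  have disj: "(#) 1 ` compositions j w \<inter> (\<lambda>a. Suc (hd a) # tl a) ` compositions (Suc j) w = {}"
    using ne(2) by fastforce
  show ?thesis
    unfolding compositions_Suc_Suc
    by (subst sum.union_disjoint[OF _ _ disj])
       (simp_all add: finite_compositions sum.reindex inj)
qed

text \<open>Splits off the first letter of the word encoding the index: the first entry either is a 1
  that can be deleted, or exceeds 1 and can be lowered.\<close>

lemma block_sum_Suc:
  "block_sum (Suc k # ks) t \<phi> =
     (if k = 0 then block_sum ks t (\<lambda>w. \<phi> (1 # w))
      else block_sum (k # ks) t (\<lambda>w. \<phi> (Suc (hd w) # tl w)))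
     + (if t = 0 then 0 else block_sum (Suc k # ks) (t - 1) (\<lambda>w. \<phi> (1 # w)))"
proof -
  let ?b = "\<lambda>j a. block_sum ks (t - j) (\<lambda>w. \<phi> (a @ w))"
  have "block_sum (Suc k # ks) t \<phi> =
      (\<Sum>j\<le>t. \<Sum>a\<in>compositions j (k + j). ?b j (1 # a))
      + (\<Sum>j\<le>t. \<Sum>a\<in>compositions (Suc j) (k + j). ?b j (Suc (hd a) # tl a))"
    by (simp add: sum_compositions_Suc_Suc sum.distrib)
  \<comment> \<open>The term j = 0 needs the empty tuple to have weight k; the terms j > 0, shifted
    by one, form a block sum for t - 1.\<close>
  moreover have "(\<Sum>j\<le>t. \<Sum>a\<in>compositions j (k + j). ?b j (1 # a)) =
      (if k = 0 then block_sum ks t (\<lambda>w. \<phi> (1 # w)) else 0)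
      + (if t = 0 then 0 else block_sum (Suc k # ks) (t - 1) (\<lambda>w. \<phi> (1 # w)))"
    by (cases t) (simp_all add: sum.atMost_Suc_shift compositions_0 del: sum.atMost_Suc)
  moreover have "(\<Sum>j\<le>t. \<Sum>a\<in>compositions (Suc j) (k + j). ?b j (Suc (hd a) # tl a)) =
      (if k = 0 then 0 else block_sum (k # ks) t (\<lambda>w. \<phi> (Suc (hd w) # tl w)))"
  proof (cases "k = 0")
    case True
    then show ?thesis
      by (simp add: compositions_empty)
  next
    case False
    have "?b j (Suc (hd a) # tl a) =
        block_sum ks (t - j) (\<lambda>w. \<phi> (Suc (hd (a @ w)) # tl (a @ w)))"
      if "a \<in> compositions (Suc j) (k + j)" for a j
      using that by (auto simp: compositions_def length_Suc_conv)
    with False show ?thesis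
      by simp
  qed
  ultimately show ?thesis
    by simp
qed

lemma block_sum_divide: "block_sum ks t (\<lambda>w. \<phi> w / c) = block_sum ks t \<phi> / c"
  by (induction ks arbitrary: t \<phi>) (simp_all add: sum_divide_distrib)

lemma block_sum_sum:
  "block_sum ks t (\<lambda>w. \<Sum>i\<in>I. \<phi> i w) = (\<Sum>i\<in>I. block_sum ks t (\<phi> i))"
proof (induction ks arbitrary: t \<phi>)
  case (Cons k ks)
  let ?b = "\<lambda>i j a. block_sum ks (t - j) (\<lambda>w. \<phi> i (a @ w))"
  have "block_sum (k # ks) t (\<lambda>w. \<Sum>i\<in>I. \<phi> i w) =
      (\<Sum>j\<le>t. \<Sum>a\<in>compositions (Suc j) (k + j). \<Sum>i\<in>I. ?b i j a)"
    by (simp add: Cons)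
  also have "\<dots> = (\<Sum>j\<le>t. \<Sum>i\<in>I. \<Sum>a\<in>compositions (Suc j) (k + j). ?b i j a)"
    by (intro sum.cong refl sum.swap)
  also have "\<dots> = (\<Sum>i\<in>I. \<Sum>j\<le>t. \<Sum>a\<in>compositions (Suc j) (k + j). ?b i j a)"
    by (rule sum.swap)
  finally show ?case
    by simp
qed simp

text \<open>The first block has at least one entry, so \<open>\<phi>\<close> is never evaluated at
  \<open>[]\<close>, where \<open>hd\<close> is unspecified.\<close>

lemma block_sum_cong_nonempty:
  assumes "\<And>w. w \<noteq> [] \<Longrightarrow> \<phi> w = \<psi> w"
  shows "block_sum (k # ks) t \<phi> = block_sum (k # ks) t \<psi>"
proof -
  have "block_sum ks s (\<lambda>w. \<phi> (a @ w)) = block_sum ks s (\<lambda>w. \<psi> (a @ w))"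
    if "a \<in> compositions (Suc j) v" for a j v s
  proof -
    have "a \<noteq> []"
      using that by (auto simp: compositions_def)
    then show ?thesis
      by (simp add: assms)
  qed
  then show ?thesis
    by simp
qed

abbreviation block_coeff :: "nat list \<Rightarrow> nat \<Rightarrow> nat \<Rightarrow> real" where
  "block_coeff ks n t \<equiv> block_sum ks t (\<lambda>w. nested 0 w n)"

lemma block_sum_nested_one:
  "block_sum ks t (\<lambda>w. nested 0 (1 # w) n) = (\<Sum>m<n. block_coeff ks m t) / real n"
  by (simp add: block_sum_divide block_sum_sum)

text \<open>\<open>block_gf_one\<close> read coefficientwise in x: the factor x becomes the shift
  from t - 1 to t.\<close>

lemma block_coeff_one:
  "block_coeff (Suc 0 # ks) n t =
     ((\<Sum>m<n. block_coeff ks m t)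
      + (if t = 0 then 0 else \<Sum>m<n. block_coeff (Suc 0 # ks) m (t - 1))) / real n"
  unfolding block_sum_Suc[of 0 ks t "\<lambda>w. nested 0 w n"] block_sum_nested_one
  by (simp add: add_divide_distrib)

lemma block_coeff_Suc:
  assumes "k \<ge> 1"
  shows "block_coeff (Suc k # ks) n t =
     (block_coeff (k # ks) n t
      + (if t = 0 then 0 else \<Sum>m<n. block_coeff (Suc k # ks) m (t - 1))) / real n"
proof -
  have "block_sum (k # ks) t (\<lambda>w. nested 0 (Suc (hd w) # tl w) n) =
      block_sum (k # ks) t (\<lambda>w. nested 0 w n / real n)"
    by (rule block_sum_cong_nonempty) (metis list.collapse nested_Suc)
  then show ?thesis
    using assms
    unfolding block_sum_Suc[of k ks t "\<lambda>w. nested 0 w n"] block_sum_nested_one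
    by (simp add: add_divide_distrib block_sum_divide del: block_sum.simps)
qed

lemma sums_shift_power:
  fixes f :: "nat \<Rightarrow> real"
  assumes "(\<lambda>t. f t * x ^ t) sums s"
  shows "(\<lambda>t. (if t = 0 then 0 else f (t - 1)) * x ^ t) sums (x * s)"
proof -
  have "(\<lambda>t. (if Suc t = 0 then 0 else f (Suc t - 1)) * x ^ Suc t) sums (x * s)"
    using sums_mult[OF assms, of x] by (simp add: mult_ac)
  from sums_Suc[OF this] show ?thesis
    by simp
qed

lemma block_coeff_step_sums:
  fixes x :: real
  assumes "(\<lambda>t. a t * x ^ t) sums A"
    and "\<And>m. m < n \<Longrightarrow> (\<lambda>t. b m t * x ^ t) sums B m"
  shows "(\<lambda>t. (a t + (if t = 0 then 0 else \<Sum>m<n. b m (t - 1))) / c * x ^ t)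
           sums ((A + x * (\<Sum>m<n. B m)) / c)"
proof -
  have "(\<lambda>t. (\<Sum>m<n. b m t) * x ^ t) sums (\<Sum>m<n. B m)"
    using sums_sum[of "{..<n}" "\<lambda>m t. b m t * x ^ t" B] assms(2) by (simp add: sum_distrib_right)
  from sums_divide[OF sums_add[OF assms(1) sums_shift_power[OF this]], of c]
  show ?thesis
    by (simp add: algebra_simps)
qed

text \<open>Both sides obey the same recursion. The inductions run over the index, its first entry,
  and n, since an inserted letter refers back to the same index at smaller m; each step combines
  finitely many series.\<close>

lemma block_coeff_sums:
  assumes "\<forall>k\<in>set ks. 1 \<le> k"
  shows "(\<lambda>t. block_coeff ks n t * x ^ t) sums block_gf x ks n"
  using assms
proof (induction ks arbitrary: n)
  case Nil
  have "(\<lambda>t. block_coeff [] n t * x ^ t) = (\<lambda>t. if t = 0 then nested 0 [] n else 0)"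
    by auto
  moreover have "nested 0 [] n = block_gf x [] n"
    by (cases n) (simp_all add: block_gf_Nil pochhammer_rec)
  ultimately show ?case
    using sums_single[of 0 "\<lambda>_. nested 0 [] n"] by simp
next
  case (Cons k ks)
  have "1 \<le> k"
    using Cons.prems by simp
  then show ?case
  proof (induction k arbitrary: n rule: nat_induct_at_least)
    case base
    have "(\<lambda>t. block_coeff (Suc 0 # ks) n t * x ^ t) sums block_gf x (Suc 0 # ks) n"
    proof (induction n rule: less_induct)
      case (less n)
      have "(\<lambda>t. (\<Sum>m<n. block_coeff ks m t) * x ^ t) sums (\<Sum>m<n. block_gf x ks m)"
        using sums_sum[of "{..<n}" "\<lambda>m t. block_coeff ks m t * x ^ t"] Cons
        by (simp add: sum_distrib_right)
      then show ?case
        unfolding block_coeff_one[where n = n] block_gf_one[where n = n]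
        by (rule block_coeff_step_sums) (rule less)
    qed
    then show ?case
      by (simp only: One_nat_def)
  next
    case (Suc k)
    show ?case
    proof (induction n rule: less_induct)
      case (less n)
      show ?case
        unfolding block_coeff_Suc[OF Suc.hyps, where n = n] block_gf_Suc[where n = n]
        by (rule block_coeff_step_sums[OF Suc.IH]) (rule less)
    qed
  qed
qed

section \<open>The sums in the theorem as recursive functionals\<close>

text \<open>Since l equals \<open>sum_list es\<close>, the triple sum is one sum over pairs of total
  t.\<close>

definition ohno_set :: "nat list \<Rightarrow> nat \<Rightarrow> (nat list \<times> nat list) set" where
  "ohno_set ks t = {(ms, es). length ms = length ks - 1 \<and>
     length es = length (insert_ones ks ms) \<and> sum_list ms + sum_list es = t}"

text \<open>Same as \<open>ohno_set\<close>, with \<open>m\<close> further ones in front of the index.\<close>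

definition ohno_ones_set :: "nat list \<Rightarrow> nat \<Rightarrow> (nat \<times> nat list \<times> nat list) set" where
  "ohno_ones_set ks t = {(m, ms, es). length ms = length ks - 1 \<and>
     length es = m + length (insert_ones ks ms) \<and> m + sum_list ms + sum_list es = t}"

definition ohno_sum :: "nat list \<Rightarrow> nat \<Rightarrow> (nat list \<Rightarrow> real) \<Rightarrow> real" where
  "ohno_sum ks t \<phi> = (\<Sum>(ms, es)\<in>ohno_set ks t. \<phi> (map2 (+) (insert_ones ks ms) es))"

definition ohno_ones_sum :: "nat list \<Rightarrow> nat \<Rightarrow> (nat list \<Rightarrow> real) \<Rightarrow> real" where
  "ohno_ones_sum ks t \<phi> =
     (\<Sum>(m, ms, es)\<in>ohno_ones_set ks t. \<phi> (map2 (+) (replicate m 1 @ insert_ones ks ms) es))"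

lemma finite_ohno_ones_set: "finite (ohno_ones_set ks t)"
proof (rule finite_subset)
  let ?W = "\<lambda>m. \<Union>w\<le>t. weak_compositions m w"
  show "ohno_ones_set ks t \<subseteq>
      (SIGMA m:{..t}. SIGMA ms:?W (length ks - 1). ?W (m + length (insert_ones ks ms)))"
    by (auto simp: ohno_ones_set_def weak_compositions_def)
  show "finite (SIGMA m:{..t}. SIGMA ms:?W (length ks - 1). ?W (m + length (insert_ones ks ms)))"
    by (intro finite_SigmaI finite_UN_I finite_weak_compositions) auto
qed

lemma insert_ones_singleton: "insert_ones [k] ms = [k]"
  by (simp add: insert_ones_def)

lemma insert_ones_Cons:
  "ks \<noteq> [] \<Longrightarrow> insert_ones (k # ks) (m # ms) = k # replicate m 1 @ insert_ones ks ms"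
  by (simp add: insert_ones_def)

lemma insert_ones_nonempty: "insert_ones ks ms \<noteq> []"
  by (simp add: insert_ones_def)

lemma ohno_sum_singleton: "ohno_sum [k] t \<phi> = \<phi> [k + t]"
proof -
  have "ohno_set [k] t = {([], [t])}"
    by (auto simp: ohno_set_def insert_ones_singleton length_Suc_conv)
  then show ?thesis
    by (simp add: ohno_sum_def insert_ones_singleton)
qed

text \<open>The first entry takes its raise e with it; the ones inserted after it become the leading
  ones of what remains.\<close>

lemma ohno_sum_Cons:
  assumes "ks \<noteq> []"
  shows "ohno_sum (k # ks) t \<phi> = (\<Sum>e\<le>t. ohno_ones_sum ks (t - e) (\<lambda>w. \<phi> ((k + e) # w)))"
proof -
  let ?g = "\<lambda>(e, m, ms, es). \<phi> ((k + e) # map2 (+) (replicate m 1 @ insert_ones ks ms) es)"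
  let ?S = "SIGMA e:{..t}. ohno_ones_set ks (t - e)"
  have "ohno_sum (k # ks) t \<phi> = sum ?g ?S"
    unfolding ohno_sum_def
  proof (rule sum.reindex_bij_witness[where
        i = "\<lambda>(e, m, ms, es). (m # ms, e # es)" and
        j = "\<lambda>(ms, es). (hd es, hd ms, tl ms, tl es)"], goal_cases)
    case (1 a)
    then show ?case
      using assms
      by (cases "fst a"; cases "snd a") (auto simp: ohno_set_def insert_ones_nonempty)
  next
    case (2 a)
    then show ?case
      using assms
      by (cases "fst a"; cases "snd a")
         (auto simp: ohno_set_def ohno_ones_set_def insert_ones_Cons insert_ones_nonempty)
  next
    case (3 b)
    then show ?case
      by auto
  next
    case (4 b)
    then show ?case
      using assms
      by (auto simp: ohno_set_def ohno_ones_set_def insert_ones_Cons Suc_diff_Suc)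
  next
    case (5 a)
    then show ?case
      using assms
      by (cases "fst a"; cases "snd a")
         (auto simp: ohno_set_def ohno_ones_set_def insert_ones_Cons insert_ones_nonempty)
  qed
  also have "\<dots> = (\<Sum>e\<le>t. ohno_ones_sum ks (t - e) (\<lambda>w. \<phi> ((k + e) # w)))"
    unfolding ohno_ones_sum_def
    by (subst sum.Sigma[symmetric]) (auto simp: finite_ohno_ones_set intro!: sum.cong)
  finally show ?thesis .
qed

text \<open>Either m = 0, or the first inserted one is split off together with its raise e; it uses
  up 1 + e of t.\<close>

lemma ohno_ones_sum_rec:
  "ohno_ones_sum ks t \<phi> = ohno_sum ks t \<phi>
     + (\<Sum>e<t. ohno_ones_sum ks (t - 1 - e) (\<lambda>w. \<phi> (Suc e # w)))"
proof -
  let ?f = "\<lambda>(m, ms, es). \<phi> (map2 (+) (replicate m 1 @ insert_ones ks ms) es)"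
  let ?Z = "{p \<in> ohno_ones_set ks t. fst p = 0}" and ?P = "{p \<in> ohno_ones_set ks t. fst p \<noteq> 0}"
  let ?g = "\<lambda>(e, m, ms, es). \<phi> (Suc e # map2 (+) (replicate m 1 @ insert_ones ks ms) es)"
  have "ohno_ones_sum ks t \<phi> = sum ?f (?Z \<union> ?P)"
    unfolding ohno_ones_sum_def by (intro sum.cong) auto
  also have "\<dots> = sum ?f ?Z + sum ?f ?P"
    by (intro sum.union_disjoint) (auto simp: finite_ohno_ones_set)
  also have "sum ?f ?Z = ohno_sum ks t \<phi>"
    unfolding ohno_sum_def
    by (rule sum.reindex_bij_witness[where i = "\<lambda>q. (0, q)" and j = snd])
       (auto simp: ohno_set_def ohno_ones_set_def)
  also have "sum ?f ?P = sum ?g (SIGMA e:{..<t}. ohno_ones_set ks (t - 1 - e))"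
  proof (rule sum.reindex_bij_witness[where
        i = "\<lambda>(e, m, ms, es). (Suc m, ms, e # es)" and
        j = "\<lambda>(m, ms, es). (hd es, m - 1, ms, tl es)"], goal_cases)
    case (1 a)
    then show ?case
      by (cases "snd (snd a)") (auto simp: ohno_ones_set_def)
  next
    case (2 a)
    then show ?case
      by (cases "snd (snd a)") (auto simp: ohno_ones_set_def)
  next
    case (3 b)
    then show ?case
      by auto
  next
    case (4 b)
    then show ?case
      by (auto simp: ohno_ones_set_def)
  next
    case (5 a)
    then show ?case
      by (cases "snd (snd a)"; cases "fst a") (auto simp: ohno_ones_set_def)
  qed
  also have "\<dots> = (\<Sum>e<t. ohno_ones_sum ks (t - 1 - e) (\<lambda>w. \<phi> (Suc e # w)))"
    unfolding ohno_ones_sum_def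
    by (subst sum.Sigma[symmetric]) (auto simp: finite_ohno_ones_set intro!: sum.cong)
  finally show ?thesis .
qed

lemma ohno_sum_eq:
  "(\<Sum>l=0..t. \<Sum>ms\<in>weak_compositions (length ks - 1) (t - l).
      \<Sum>es\<in>weak_compositions (length (insert_ones ks ms)) l.
        \<phi> (map2 (+) (insert_ones ks ms) es)) = ohno_sum ks t \<phi>"
proof -
  let ?S = "SIGMA l:{0..t}. SIGMA ms:weak_compositions (length ks - 1) (t - l).
      weak_compositions (length (insert_ones ks ms)) l"
  let ?f = "\<lambda>(l, ms, es). \<phi> (map2 (+) (insert_ones ks ms) es)"
  have "(\<Sum>l=0..t. \<Sum>ms\<in>weak_compositions (length ks - 1) (t - l).
      \<Sum>es\<in>weak_compositions (length (insert_ones ks ms)) l.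
        \<phi> (map2 (+) (insert_ones ks ms) es)) = sum ?f ?S"
    by (simp add: sum.Sigma finite_weak_compositions)
  also have "\<dots> = ohno_sum ks t \<phi>"
    unfolding ohno_sum_def
    by (rule sum.reindex_bij_witness[where i = "\<lambda>(ms, es). (sum_list es, ms, es)" and j = snd])
       (auto simp: ohno_set_def weak_compositions_def)
  finally show ?thesis .
qed

lemma block_sum_eq:
  "(\<Sum>ms\<in>compositions (length ks) (length ks + t). \<Sum>as\<in>block_families ks ms. \<phi> (concat as))
     = block_sum ks t \<phi>"
proof (induction ks arbitrary: t \<phi>)
  case Nil
  show ?case
    by (auto simp: compositions_0 block_families_def)
next
  case (Cons k ks)
  let ?r = "length ks"
  let ?F = "\<lambda>m ms. block_families (k # ks) (m # ms)"
  have fam: "(\<Sum>as\<in>?F m ms. \<phi> (concat as)) =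
      (\<Sum>a\<in>compositions m (k + m - 1). \<Sum>as\<in>block_families ks ms. \<phi> (a @ concat as))" for m ms
  proof -
    have "?F m ms = (\<lambda>(a, as). a # as) ` (compositions m (k + m - 1) \<times> block_families ks ms)"
    proof (intro equalityI subsetI)
      fix as assume "as \<in> ?F m ms"
      then obtain b bs where "as = b # bs" "length bs = ?r"
          "\<forall>i<Suc ?r. as ! i \<in> compositions ((m # ms) ! i) ((k # ks) ! i + (m # ms) ! i - 1)"
        by (auto simp: block_families_def length_Suc_conv)
      then have "b \<in> compositions m (k + m - 1)" "bs \<in> block_families ks ms"
        by (fastforce simp: block_families_def)+
      with \<open>as = b # bs\<close> show
          "as \<in> (\<lambda>(a, as). a # as) ` (compositions m (k + m - 1) \<times> block_families ks ms)"
        by auto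
    qed (auto simp: block_families_def nth_Cons split: nat.splits)
    then have "(\<Sum>as\<in>?F m ms. \<phi> (concat as)) =
        (\<Sum>(a, as)\<in>compositions m (k + m - 1) \<times> block_families ks ms. \<phi> (a @ concat as))"
      by (simp add: sum.reindex inj_on_def case_prod_unfold prod_eq_iff)
    then show ?thesis
      by (simp add: sum.cartesian_product)
  qed
  have "(\<Sum>ms\<in>compositions (Suc ?r) (Suc ?r + t). \<Sum>as\<in>block_families (k # ks) ms. \<phi> (concat as)) =
      (\<Sum>(j, ms)\<in>(SIGMA j:{..t}. compositions ?r (?r + (t - j))).
        \<Sum>as\<in>?F (Suc j) ms. \<phi> (concat as))"
  proof (rule sum.reindex_bij_witness[where
        i = "\<lambda>(j, ms). Suc j # ms" and j = "\<lambda>ms. (hd ms - 1, tl ms)"], goal_cases)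
    case (1 a)
    then show ?case
      by (cases a) (auto simp: compositions_def)
  next
    case (2 a)
    then show ?case
      \<comment> \<open>The other entries sum to at least their number, so the first one is at most
        t + 1.\<close>
      using compositions_empty[of "sum_list (tl a)" ?r]
      by (cases a) (fastforce simp: compositions_def)+
  next
    case (3 b)
    then show ?case
      by auto
  next
    case (4 b)
    then show ?case
      by (auto simp: compositions_def)
  next
    case (5 a)
    then show ?case
      by (cases a) (auto simp: compositions_def)
  qed
  also have "\<dots> = (\<Sum>j\<le>t. \<Sum>ms\<in>compositions ?r (?r + (t - j)).
      \<Sum>a\<in>compositions (Suc j) (k + j). \<Sum>as\<in>block_families ks ms. \<phi> (a @ concat as))"
    by (subst sum.Sigma[symmetric]) (simp_all add: finite_compositions fam)
  also have "\<dots> = (\<Sum>j\<le>t. \<Sum>a\<in>compositions (Suc j) (k + j).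
      \<Sum>ms\<in>compositions ?r (?r + (t - j)). \<Sum>as\<in>block_families ks ms. \<phi> (a @ concat as))"
    by (intro sum.cong refl sum.swap)
  also have "\<dots> = block_sum (k # ks) t \<phi>"
    unfolding block_sum.simps
    by (intro sum.cong refl) (rule Cons)
  finally show ?case
    by simp
qed

section \<open>Generating function of the right-hand side\<close>

text \<open>The product of \<open>j/(j-x)\<close> over \<open>1 \<le> j \<le> n\<close>; its part
  below n_r is cancelled by the innermost factor, see \<open>sum_nested_Nil\<close>.\<close>

definition beta_prod :: "real \<Rightarrow> nat \<Rightarrow> real" where
  "beta_prod x n = fact n / pochhammer (1 - x) n"

lemma beta_prod_0 [simp]: "beta_prod x 0 = 1"
  by (simp add: beta_prod_def)

lemma beta_prod_Suc: "beta_prod x (Suc n) = beta_prod x n * (real (Suc n) / (real (Suc n) - x))"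
  by (simp add: beta_prod_def pochhammer_Suc algebra_simps)

lemma beta_prod_pos: "x < 1 \<Longrightarrow> 0 < beta_prod x n"
  by (simp add: beta_prod_def pochhammer_pos)

text \<open>Partial summation divides \<open>(1-s)^x\<close> by \<open>1-s\<close>, and the
  coefficients of \<open>(1-s)^(x-1)\<close> are the reciprocals of
  \<open>beta_prod\<close>.\<close>

lemma sum_nested_Nil:
  assumes "x < 1"
  shows "(\<Sum>m<Suc n. nested x [] m) = 1 / beta_prod x n"
proof -
  have "(\<Sum>m<Suc n. nested x [] m) = pochhammer (1 - x) n / fact n"
  proof (induction n)
    case (Suc n)
    have "(\<Sum>m<Suc (Suc n). nested x [] m) =
        pochhammer (1 - x) n / fact n - x * pochhammer (1 - x) n / fact (Suc n)"
      using Suc by (simp add: pochhammer_rec[of "- x" n] del: fact_Suc)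
    also have "\<dots> = pochhammer (1 - x) n * (1 - x + real n) / fact (Suc n)"
      by (simp add: divide_simps) (simp add: algebra_simps)
    finally show ?case
      by (simp add: pochhammer_Suc)
  qed simp
  then show ?thesis
    by (simp add: beta_prod_def)
qed

text \<open>For 0 < x < 1 all coefficients of \<open>(1-s)^x\<close> after the first are negative,
  so the induction has to carry partial sums.\<close>

lemma sum_nested_nonneg:
  assumes "0 \<le> x" "x < 1"
  shows "0 \<le> (\<Sum>m<n. nested x ks m)"
proof (induction ks arbitrary: n)
  case Nil
  show ?case
  proof (cases n)
    case (Suc m)
    then show ?thesis
      using sum_nested_Nil[OF assms(2), of m] beta_prod_pos[OF assms(2), of m] by simp
  qed simp
next
  case (Cons k ks)
  then show ?case
    by (auto intro!: sum_nonneg)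
qed

lemma nested_nonneg:
  assumes "0 \<le> x" "x < 1" "ks \<noteq> []"
  shows "0 \<le> nested x ks n"
  using assms sum_nested_nonneg by (cases ks) auto

lemma nested_0_nonneg: "0 \<le> nested 0 ks n"
  using nested_nonneg[of 0 ks n] by (cases "ks = []"; cases n) (auto simp: pochhammer_rec)

lemma ohno_sum_nonneg: "(\<And>w. 0 \<le> \<phi> w) \<Longrightarrow> 0 \<le> ohno_sum ks t \<phi>"
  unfolding ohno_sum_def by (intro sum_nonneg) auto

lemma ohno_ones_sum_nonneg: "(\<And>w. 0 \<le> \<phi> w) \<Longrightarrow> 0 \<le> ohno_ones_sum ks t \<phi>"
  unfolding ohno_ones_sum_def by (intro sum_nonneg) auto

abbreviation ohno_coeff :: "nat list \<Rightarrow> nat \<Rightarrow> nat \<Rightarrow> real" where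
  "ohno_coeff ks n t \<equiv> ohno_sum ks t (\<lambda>w. nested 0 w n)"

abbreviation ohno_ones_coeff :: "nat list \<Rightarrow> nat \<Rightarrow> nat \<Rightarrow> real" where
  "ohno_ones_coeff ks n t \<equiv> ohno_ones_sum ks t (\<lambda>w. nested 0 w n)"

lemma ohno_ones_sum_nested:
  "ohno_ones_sum ks t (\<lambda>w. nested 0 (k # w) n) =
     1 / real n ^ k * (\<Sum>m<n. ohno_ones_coeff ks m t)"
proof -
  have "(\<Sum>m<n. ohno_ones_coeff ks m t) = ohno_ones_sum ks t (\<lambda>w. \<Sum>m<n. nested 0 w m)"
    unfolding ohno_ones_sum_def case_prod_unfold by (rule sum.swap)
  then show ?thesis
    by (simp add: ohno_ones_sum_def case_prod_unfold sum_divide_distrib)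
qed

lemma power_convolution_sums:
  fixes a b :: "nat \<Rightarrow> real"
  assumes "(\<lambda>t. a t * x ^ t) sums A" "(\<lambda>t. b t * x ^ t) sums B"
    and "0 \<le> x" "\<And>t. 0 \<le> a t" "\<And>t. 0 \<le> b t"
  shows "(\<lambda>t. (\<Sum>e\<le>t. a e * b (t - e)) * x ^ t) sums (A * B)"
proof -
  have "(\<Sum>e\<le>t. (a e * x ^ e) * (b (t - e) * x ^ (t - e))) = (\<Sum>e\<le>t. a e * b (t - e)) * x ^ t"
    for t
    unfolding sum_distrib_right
    by (intro sum.cong refl) (simp add: power_add[symmetric] mult.assoc mult.left_commute)
  then show ?thesis
    using Cauchy_product_sums[of "\<lambda>t. a t * x ^ t" "\<lambda>t. b t * x ^ t"] assms
    by (simp add: sums_iff)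
qed

text \<open>Summing over the raises e of the exponent at n: a geometric series of ratio x/n.\<close>

lemma geometric_power_sums:
  assumes "0 \<le> x" "x < 1" "n > 0"
  shows "(\<lambda>e. 1 / real n ^ (k + e) * x ^ e) sums (1 / real n ^ k * (real n / (real n - x)))"
proof -
  have "(\<lambda>e. (x / real n) ^ e) sums (1 / (1 - x / real n))"
    using assms by (intro geometric_sums) auto
  from sums_mult[OF this, of "1 / real n ^ k"] show ?thesis
    using assms by (simp add: power_add power_divide field_simps)
qed

text \<open>Inserted ones supply the factors \<open>j/(j-x)\<close> with m < j < n, completing every
  \<open>beta_prod x m\<close> to \<open>beta_prod x (n - 1)\<close>. So the sum over all positions
  below n is \<open>T n\<close>, and a single position gives a difference.\<close>

lemma ohno_ones_coeff_sums:
  assumes x: "0 \<le> x" "x < 1"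
    and ohno: "\<And>n. (\<lambda>t. ohno_coeff ks n t * x ^ t) sums (nested x ks n * beta_prod x n)"
  defines "T \<equiv> \<lambda>n. beta_prod x (n - 1) * (\<Sum>m<n. nested x ks m)"
  shows "(\<lambda>t. ohno_ones_coeff ks n t * x ^ t) sums (T (Suc n) - T n)"
proof (induction n rule: less_induct)
  case (less n)
  \<comment> \<open>Rests on \<open>beta_prod x n = beta_prod x (n - 1) * (1 + x / (n - x))\<close>;
    the summands match m = 0 and m > 0 in \<open>ohno_ones_sum_rec\<close>. At n = 0 the truncated n
    - 1 is harmless because \<open>T 0\<close> has an empty sum.\<close>
  have T: "T (Suc n) - T n = nested x ks n * beta_prod x n + x * (1 / (real n - x) * T n)"
  proof (cases n)
    case 0
    then show ?thesis
      by (simp add: T_def)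
  next
    case (Suc m)
    have "real (Suc m) - x \<noteq> 0"
      using x by simp
    then show ?thesis
      unfolding T_def Suc
      by (simp add: beta_prod_Suc divide_simps del: of_nat_Suc) (simp add: algebra_simps)
  qed
  have Q: "(\<lambda>t. (\<Sum>m<n. ohno_ones_coeff ks m t) * x ^ t) sums T n"
    using sums_sum[of "{..<n}" "\<lambda>m t. ohno_ones_coeff ks m t * x ^ t", OF less]
    by (simp add: sum_distrib_right sum_lessThan_telescope) (simp add: T_def)
  let ?c = "\<lambda>t. \<Sum>e\<le>t. 1 / real n ^ (1 + e) * (\<Sum>m<n. ohno_ones_coeff ks m (t - e))"
  have c: "(\<lambda>t. ?c t * x ^ t) sums (1 / (real n - x) * T n)"
  proof (cases "n = 0")
    case True
    then show ?thesis
      by (simp add: T_def)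
  next
    case False
    then show ?thesis
      using power_convolution_sums[OF geometric_power_sums[OF x, of n 1] Q]
      by (simp add: x sum_nonneg ohno_ones_sum_nonneg nested_0_nonneg)
  qed
  have rec: "ohno_ones_coeff ks n t = ohno_coeff ks n t + (if t = 0 then 0 else ?c (t - 1))" for t
    unfolding ohno_ones_sum_rec[where \<phi> = "\<lambda>w. nested 0 w n"] ohno_ones_sum_nested
    by (cases t) (simp_all add: lessThan_Suc_atMost)
  show ?case
    unfolding rec T distrib_right
    by (intro sums_add ohno sums_shift_power c)
qed

text \<open>Raising the first exponent supplies the factor n/(n-x), which turns
  \<open>beta_prod x (n - 1)\<close> into \<open>beta_prod x n\<close>; the earlier factors come
  from the inserted ones or, in depth one, cancel by \<open>sum_nested_Nil\<close>.\<close>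

lemma ohno_coeff_sums:
  assumes x: "0 \<le> x" "x < 1" and "ks \<noteq> []"
  shows "(\<lambda>t. ohno_coeff ks n t * x ^ t) sums (nested x ks n * beta_prod x n)"
  using \<open>ks \<noteq> []\<close>
proof (induction ks arbitrary: n rule: list_nonempty_induct)
  case (single k)
  show ?case
  proof (cases n)
    case 0
    then show ?thesis
      by (simp add: ohno_sum_singleton)
  next
    case (Suc m)
    have nz: "real (Suc m) - x \<noteq> 0" "beta_prod x m \<noteq> 0"
      using x beta_prod_pos[of x m] by auto
    have "ohno_coeff [k] n t = 1 / real n ^ (k + t)" for t
      using sum_nested_Nil[of 0 m]
      by (simp add: ohno_sum_singleton Suc beta_prod_def pochhammer_fact[symmetric])
    moreover have "nested x [k] n * beta_prod x n = 1 / real n ^ k * (real n / (real n - x))"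
      using nz sum_nested_Nil[OF x(2), of m]
      by (simp add: Suc beta_prod_Suc del: of_nat_Suc nested.simps(1) sum.lessThan_Suc)
    ultimately show ?thesis
      using geometric_power_sums[OF x, of n k] Suc by simp
  qed
next
  case (cons k ks)
  show ?case
  proof (cases n)
    case 0
    then show ?thesis
      by (simp add: ohno_sum_Cons[OF cons.hyps] ohno_ones_sum_nested del: nested.simps)
         simp
  next
    case (Suc m)
    define T where "T = (\<lambda>n. beta_prod x (n - 1) * (\<Sum>m<n. nested x ks m))"
    have "(\<lambda>t. ohno_ones_coeff ks m t * x ^ t) sums (T (Suc m) - T m)" for m
      unfolding T_def by (rule ohno_ones_coeff_sums[OF x cons.IH])
    then have "(\<lambda>t. \<Sum>m<n. ohno_ones_coeff ks m t * x ^ t) sums (\<Sum>m<n. T (Suc m) - T m)"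
      by (intro sums_sum)
    then have "(\<lambda>t. (\<Sum>m<n. ohno_ones_coeff ks m t) * x ^ t) sums T n"
      by (simp add: sum_distrib_right sum_lessThan_telescope) (simp add: T_def)
    from power_convolution_sums[OF geometric_power_sums[OF x, of n k] this]
    have "(\<lambda>t. (\<Sum>e\<le>t. 1 / real n ^ (k + e) * (\<Sum>m<n. ohno_ones_coeff ks m (t - e))) * x ^ t)
        sums (1 / real n ^ k * (real n / (real n - x)) * T n)"
      using Suc by (simp add: x sum_nonneg ohno_ones_sum_nonneg nested_0_nonneg)
    moreover have "1 / real n ^ k * (real n / (real n - x)) * T n
        = nested x (k # ks) n * beta_prod x n"
      by (simp add: T_def Suc beta_prod_Suc del: of_nat_Suc)
    ultimately show ?thesis
      by (simp only: ohno_sum_Cons[OF cons.hyps] ohno_ones_sum_nested)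
  qed
qed

section \<open>Interchange of summation and the Beta series\<close>

text \<open>Tonelli: for nonnegative terms, convergence of the iterated sum gives joint unordered
  summability, which is symmetric in both variables.\<close>

lemma sums_swap_nonneg:
  fixes a :: "nat \<Rightarrow> nat \<Rightarrow> real"
  assumes nonneg: "\<And>n t. 0 \<le> a n t" and rows: "\<And>n. a n sums b n" and total: "b sums S"
  shows "(\<lambda>t. \<Sum>n. a n t) sums S"
proof -
  have b: "0 \<le> b n" for n
    using sums_le[OF _ sums_zero rows] nonneg by simp
  have rows': "((\<lambda>t. (\<lambda>(n, t). a n t) (n, t)) has_sum b n) UNIV" for n
    using sums_nonneg_imp_has_sum[OF rows nonneg] by simp
  have total': "(b has_sum S) UNIV"
    using sums_nonneg_imp_has_sum[OF total b] .
  have "(\<lambda>(n, t). a n t) summable_on UNIV \<times> UNIV"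
    by (rule summable_on_SigmaI[OF rows']) (use total' nonneg in \<open>auto simp: summable_on_def\<close>)
  from has_sum_SigmaI[OF rows' total' this]
  have "((\<lambda>(n, t). a n t) has_sum S) (UNIV \<times> UNIV)" .
  then have swapped: "((\<lambda>(t, n). a n t) has_sum S) (UNIV \<times> UNIV)"
    by (subst has_sum_reindex_bij_betw[of prod.swap _ "UNIV \<times> UNIV", symmetric])
       (auto simp: case_prod_unfold bij_betw_def)
  have columns: "(\<lambda>n. a n t) summable_on UNIV" for t
    using summable_on_SigmaD1[of "\<lambda>t n. a n t" UNIV "\<lambda>_. UNIV" t] swapped
    by (auto simp: summable_on_def)
  have "((\<lambda>t. \<Sum>\<^sub>\<infinity>n. a n t) has_sum S) UNIV"
    using has_sum_SigmaD[OF swapped, of "\<lambda>t. \<Sum>\<^sub>\<infinity>n. a n t"] columns by simp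
  moreover have "(\<Sum>\<^sub>\<infinity>n. a n t) = (\<Sum>n. a n t)" for t
    using has_sum_imp_sums[OF has_sum_infsum[OF columns]] by (simp add: sums_iff)
  ultimately show ?thesis
    using has_sum_imp_sums by fastforce
qed

text \<open>Values are known only for x > 0: once the lower coefficients vanish, divide by
  \<open>x ^ t\<close> and let x tend to 0 from the right.\<close>

lemma power_series_coeff_zero:
  fixes d :: "nat \<Rightarrow> real"
  assumes "0 < s" and zero: "\<And>x. 0 < x \<Longrightarrow> x \<le> s \<Longrightarrow> (\<lambda>t. d t * x ^ t) sums 0"
  shows "d t = 0"
proof (induction t rule: less_induct)
  case (less t)
  define f where "f x = (\<Sum>n. d (n + t) * x ^ n)" for x
  have shift: "(\<lambda>n. d (n + t) * x ^ n) sums 0" if "0 < x" "x \<le> s" for x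
  proof -
    have "(\<lambda>n. d (n + t) * x ^ (n + t)) sums 0"
      using zero[OF that] less by (subst sums_iff_shift) simp
    from sums_divide[OF this, of "x ^ t"] show ?thesis
      using that by (simp add: power_add)
  qed
  \<comment> \<open>Convergence at s extends to the open disc, a two-sided neighbourhood of 0 as the
    limit theorem requires.\<close>
  have "summable (\<lambda>n. d (n + t) * x ^ n)" if "norm x < s" for x
    using powser_inside[OF sums_summable[OF shift[of s]], of x] that assms(1) by simp
  then have "(f \<longlongrightarrow> d (0 + t)) (at 0)"
    unfolding f_def by (intro powser_limit_0[OF assms(1)]) (simp add: summable_sums)
  then have "(f \<longlongrightarrow> d t) (at_right 0)"
    by (simp add: filterlim_at_split)
  moreover have "eventually (\<lambda>x. f x = 0) (at_right 0)"
    unfolding eventually_at_right_field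
    using assms(1) shift by (intro exI[of _ s]) (auto simp: f_def sums_iff)
  then have "(f \<longlongrightarrow> 0) (at_right 0)"
    by (rule tendsto_eventually)
  ultimately show ?case
    using tendsto_unique trivial_limit_at_right_real by blast
qed

section \<open>Coefficients of \<open>(1-s)^(-x)\<close> and the Beta series\<close>

lemma rising_nonneg: "0 \<le> x \<Longrightarrow> 0 \<le> rising x $ n"
  by (cases "x = 0"; cases n)
     (simp_all add: rising_def pochhammer_nonneg pochhammer_0_left)

text \<open>Each ratio is \<open>1 - (1-x)/(n+1) \<le> exp (-(1-x)/(n+1))\<close>, and the harmonic
  series diverges.\<close>

lemma rising_tendsto_0:
  assumes "0 \<le> x" "x < 1"
  shows "(\<lambda>n. rising x $ n) \<longlonglongrightarrow> 0"
proof (rule tendsto_sandwich[of "\<lambda>_. 0"])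
  have "rising x $ n \<le> exp (- (1 - x) * harm n)" for n
  proof (induction n)
    case (Suc n)
    have "rising x $ Suc n = rising x $ n * ((x + real n) / real (Suc n))"
      by (simp add: rising_def pochhammer_Suc del: of_nat_Suc)
    also have "(x + real n) / real (Suc n) = 1 + - (1 - x) * inverse (real (Suc n))"
      by (simp add: field_simps)
    also have "rising x $ n * \<dots> \<le>
        exp (- (1 - x) * harm n) * exp (- (1 - x) * inverse (real (Suc n)))"
    proof (rule mult_mono[OF Suc exp_ge_add_one_self])
      show "0 \<le> 1 + - (1 - x) * inverse (real (Suc n))"
        using assms by (simp add: field_simps)
    qed simp
    also have "\<dots> = exp (- (1 - x) * harm (Suc n))"
      by (simp add: harm_Suc distrib_left exp_add[symmetric])
    finally show ?case .
  qed (simp add: rising_def harm_def)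
  then show "\<forall>\<^sub>F n in sequentially. rising x $ n \<le> exp (- (1 - x) * harm n)"
    by simp
  show "\<forall>\<^sub>F n in sequentially. 0 \<le> rising x $ n"
    using assms by (simp add: rising_nonneg)
  have "filterlim (\<lambda>n. - (1 - x) * harm n) at_bot sequentially"
    using assms harm_at_top by (intro filterlim_tendsto_neg_mult_at_bot[OF tendsto_const]) auto
  then show "(\<lambda>n. exp (- (1 - x) * harm n)) \<longlonglongrightarrow> 0"
    by (rule filterlim_compose[OF exp_at_bot])
qed simp_all

lemma rising_Suc: "real (Suc q) * rising x $ Suc q = (real q + x) * rising x $ q"
  by (simp add: rising_def pochhammer_Suc add.commute del: of_nat_Suc)

text \<open>Here \<open>beta_prod x p / p\<close> is the Beta value \<open>B(p, 1 - x)\<close>, expanded by the binomial series.\<close>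

lemma rising_beta_sums:
  assumes "0 \<le> x" "x < 1"
  shows "(\<lambda>q. rising x $ q / real (Suc p + q)) sums (beta_prod x (Suc p) / real (Suc p))"
proof (induction p)
  case 0
  have "rising x $ q - rising x $ Suc q = (1 - x) * (rising x $ q / real (Suc q))" for q
    using rising_Suc[of q x] by (simp add: field_simps)
  with telescope_sums'[OF rising_tendsto_0[OF assms]]
  have "(\<lambda>q. (1 - x) * (rising x $ q / real (Suc q))) sums 1"
    by (simp add: rising_def)
  from sums_divide[OF this, of "1 - x"] show ?case
    using assms by (simp add: beta_prod_Suc)
next
  case (Suc p)
  \<comment> \<open>Telescoping substitute for integration by parts: w starts at 0 and tends to 0,
    and its differences combine the series for p and p + 1, giving the Beta recursion.\<close>
  define w where "w q = rising x $ q * (real q / real (Suc p + q))" for q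
  have "w \<longlonglongrightarrow> 0"
  proof (rule tendsto_sandwich[of "\<lambda>_. 0" _ _ "\<lambda>q. rising x $ q"])
    have "w q \<le> rising x $ q" for q
      unfolding w_def using assms by (intro mult_left_le rising_nonneg) auto
    then show "\<forall>\<^sub>F q in sequentially. 0 \<le> w q" "\<forall>\<^sub>F q in sequentially. w q \<le> rising x $ q"
      using assms by (auto simp: w_def rising_nonneg)
  qed (use rising_tendsto_0[OF assms] in auto)
  from telescope_sums[OF this]
  have "(\<lambda>q. w (Suc q) - w q) sums 0"
    by (simp add: w_def)
  moreover have "w (Suc q) - w q = real (Suc p) * (rising x $ q / real (Suc p + q))
      - (real (Suc (Suc p)) - x) * (rising x $ q / real (Suc (Suc p) + q))" for q
  proof -
    have "w (Suc q) = (real q + x) * rising x $ q / real (Suc (Suc p) + q)"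
      by (simp add: w_def rising_Suc[symmetric])
    then show ?thesis
      by (simp add: w_def divide_simps) (simp add: algebra_simps)
  qed
  ultimately have "(\<lambda>q. real (Suc p) * (rising x $ q / real (Suc p + q))
      - (real (Suc (Suc p)) - x) * (rising x $ q / real (Suc (Suc p) + q))) sums 0"
    by simp
  from sums_diff[OF sums_mult[OF Suc, of "real (Suc p)"] this]
  have "(\<lambda>q. (real (Suc (Suc p)) - x) * (rising x $ q / real (Suc (Suc p) + q)))
      sums beta_prod x (Suc p)"
    by (simp del: of_nat_Suc)
  from sums_divide[OF this, of "real (Suc (Suc p)) - x"] show ?case
    using assms by (simp add: beta_prod_Suc[of x "Suc p"] del: of_nat_Suc)
qed

section \<open>Convergence\<close>

lemma harm_le_ln: "n > 0 \<Longrightarrow> harm n \<le> 1 + ln (real n)"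
proof -
  assume "n > 0"
  then obtain m where "n = Suc m"
    by (cases n) auto
  then show ?thesis
    using decseqD[OF decseq_harm_diff_ln, of 0 m] by (simp add: harm_def)
qed

lemma sum_inverse_le_harm: "(\<Sum>m<n. 1 / real m) \<le> harm n"
proof (cases n)
  case (Suc n')
  have "(\<Sum>m<Suc k. 1 / real m) = harm k" for k
    by (induction k) (simp_all add: harm_Suc harm_def inverse_eq_divide)
  then show ?thesis
    using harm_mono[of n' n] by (simp only: Suc) simp
qed (simp add: harm_def)

lemma beta_prod_ge_1: "0 \<le> x \<Longrightarrow> x < 1 \<Longrightarrow> 1 \<le> beta_prod x n"
proof (induction n)
  case (Suc n)
  then have "1 * 1 \<le> beta_prod x n * (real (Suc n) / (real (Suc n) - x))"
    by (intro mult_mono) auto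
  then show ?case
    by (simp add: beta_prod_Suc del: of_nat_Suc)
qed simp

text \<open>Since x \<le> 1/2, each factor satisfies
  \<open>j/(j-x) \<le> 1 + 2x/j \<le> exp (2x/j)\<close>.\<close>

lemma beta_prod_le_exp:
  assumes "0 \<le> x" "x \<le> 1 / 2"
  shows "beta_prod x n \<le> exp (2 * x * harm n)"
proof (induction n)
  case (Suc n)
  have "real (Suc n) / (real (Suc n) - x) \<le> 1 + 2 * x * inverse (real (Suc n))"
  proof -
    have "0 \<le> x * (real (Suc n) - 2 * x)"
      using assms by (intro mult_nonneg_nonneg) auto
    then show ?thesis
      using assms by (simp add: field_simps)
  qed
  also have "\<dots> \<le> exp (2 * x * inverse (real (Suc n)))"
    by (rule exp_ge_add_one_self)
  finally have "beta_prod x (Suc n) \<le> exp (2 * x * harm n) * exp (2 * x * inverse (real (Suc n)))"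
    unfolding beta_prod_Suc using Suc assms by (intro mult_mono) auto
  also have "\<dots> = exp (2 * x * harm (Suc n))"
    by (simp add: harm_Suc distrib_left exp_add[symmetric])
  finally show ?case .
qed (simp add: harm_def)

text \<open>As exponents are at least 1, every variable costs at most one factor
  \<open>harm n\<close>; the innermost sum is at most 1.\<close>

lemma sum_nested_le_harm:
  assumes "0 \<le> x" "x < 1" "\<forall>k\<in>set ks. 1 \<le> k"
  shows "(\<Sum>m<n. nested x ks m) \<le> harm n ^ length ks"
  using assms(3)
proof (induction ks arbitrary: n)
  case Nil
  show ?case
  proof (cases n)
    case (Suc m)
    then show ?thesis
      using sum_nested_Nil[OF assms(2), of m] beta_prod_ge_1[OF assms(1,2), of m] by simp
  qed simp
next
  case (Cons k ks)
  have "nested x (k # ks) m \<le> harm n ^ length ks * (1 / real m)" if "m < n" for m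
  proof (cases "m = 0")
    case False
    have "(\<Sum>j<m. nested x ks j) \<le> harm m ^ length ks"
      using Cons by simp
    also have "\<dots> \<le> harm n ^ length ks"
      using that by (intro power_mono harm_mono harm_nonneg) simp
    finally have "(\<Sum>j<m. nested x ks j) \<le> harm n ^ length ks" .
    moreover have "1 / real m ^ k \<le> 1 / real m"
      using False Cons.prems self_le_power[of "real m" k] by (intro divide_left_mono) auto
    ultimately have "(\<Sum>j<m. nested x ks j) * (1 / real m ^ k) \<le> harm n ^ length ks * (1 / real m)"
      by (intro mult_mono) (auto simp: harm_nonneg)
    then show ?thesis
      by simp
  qed simp
  then have "(\<Sum>m<n. nested x (k # ks) m) \<le> (\<Sum>m<n. harm n ^ length ks * (1 / real m))"
    by (intro sum_mono) auto
  also have "\<dots> \<le> harm n ^ length ks * harm n"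
    unfolding sum_distrib_left[symmetric]
    by (intro mult_left_mono sum_inverse_le_harm) (simp add: harm_nonneg)
  finally show ?case
    by (simp add: mult.commute)
qed

text \<open>Raise \<open>u \<le> exp u\<close> to the r-th power at
  \<open>u = harm n / (4 * (real r + 1))\<close>; the + 1 keeps the divisor nonzero at r =
  0.\<close>

lemma harm_power_le_exp: "(harm n :: real) ^ r \<le> (4 * (real r + 1)) ^ r * exp (harm n / 4)"
proof -
  let ?c = "4 * (real r + 1)"
  have "(harm n / ?c) ^ r \<le> exp (harm n / ?c) ^ r"
  proof (rule power_mono)
    show "harm n / ?c \<le> exp (harm n / ?c)"
      using exp_ge_add_one_self[of "harm n / ?c"] by linarith
  qed (simp add: harm_nonneg)
  also have "\<dots> = exp (real r * (harm n / ?c))"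
    by (rule exp_of_nat_mult[symmetric])
  also have "\<dots> \<le> exp (harm n / 4)"
    using harm_nonneg[of n, where 'a = real] by (simp add: field_simps)
  finally show ?thesis
    by (simp add: power_divide field_simps)
qed

text \<open>With \<open>exp (harm n)\<close> of order n, the bound 1/8 keeps
  \<open>beta_prod\<close> of order at most n^(1/4), and the powers of \<open>harm n\<close> cost
  another n^(1/4). Against 1/n^2 from the first exponent and the division by n this leaves
  n^(-3/2).\<close>

lemma summable_nested_beta_prod:
  assumes x: "0 \<le> x" "x \<le> 1 / 8" and ks: "ks \<noteq> []" "\<forall>k\<in>set ks. 1 \<le> k"
  shows "summable (\<lambda>n. nested x ks n * beta_prod x n / real n)"
proof -
  obtain k ks' where ks_eq: "ks = k # ks'"
    using ks(1) by (cases ks) auto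
  \<comment> \<open>\<open>exp (1 / 2)\<close> comes from \<open>harm n \<le> 1 + ln n\<close> when
    estimating \<open>exp (harm n / 2)\<close>.\<close>
  define C where "C = (4 * (real (length ks') + 1)) ^ length ks' * exp (1 / 2)"
  have bound: "norm (nested x ks n * beta_prod x n / real n) \<le> C * real n powr (- 3 / 2)"
    if "n \<ge> 1" for n
  proof -
    let ?h = "harm n :: real"
    have "nested x ks n \<le> ?h ^ length ks' / real n"
    proof -
      have "(\<Sum>m<n. nested x ks' m) \<le> ?h ^ length ks'"
        using x ks by (intro sum_nested_le_harm) (auto simp: ks_eq)
      moreover have "real n ^ k \<ge> real n"
        using that ks by (intro self_le_power) (auto simp: ks_eq)
      ultimately show ?thesis
        using that by (simp add: ks_eq) (intro frac_le, auto simp: harm_nonneg)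
    qed
    moreover have "beta_prod x n \<le> exp (?h / 4)"
    proof -
      have "2 * x * ?h \<le> 1 / 4 * ?h"
        using x by (intro mult_right_mono) (auto simp: harm_nonneg)
      then have "exp (2 * x * ?h) \<le> exp (?h / 4)"
        by simp
      then show ?thesis
        using beta_prod_le_exp[of x n] x by linarith
    qed
    ultimately have "nested x ks n * beta_prod x n \<le> ?h ^ length ks' / real n * exp (?h / 4)"
      using beta_prod_pos[of x n] x by (intro mult_mono) (auto simp: harm_nonneg)
    also have "\<dots> \<le> (4 * (real (length ks') + 1)) ^ length ks' * exp (?h / 4) / real n * exp (?h / 4)"
      by (intro mult_right_mono divide_right_mono harm_power_le_exp) auto
    also have "\<dots> = (4 * (real (length ks') + 1)) ^ length ks' * exp (?h / 2) / real n"
      by (simp add: exp_add[symmetric])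
    also have "\<dots> \<le> (4 * (real (length ks') + 1)) ^ length ks' * exp ((1 + ln (real n)) / 2) / real n"
      using harm_le_ln[of n] that by (intro divide_right_mono mult_left_mono) auto
    also have "exp ((1 + ln (real n)) / 2) = exp (1 / 2) * real n powr (1 / 2)"
      using that by (simp add: powr_def add_divide_distrib exp_add)
    finally have "nested x ks n * beta_prod x n \<le> C * real n powr (1 / 2) / real n"
      by (simp add: C_def mult.assoc)
    then have "nested x ks n * beta_prod x n / real n \<le> C * real n powr (1 / 2) / real n / real n"
      by (rule divide_right_mono) simp
    also have "\<dots> = C * (real n powr (1 / 2) / real n powr 2)"
      using that by (simp add: powr_numeral power2_eq_square)
    also have "\<dots> = C * real n powr (- 3 / 2)"
      by (simp only: powr_diff[symmetric]) simp
    finally have "nested x ks n * beta_prod x n / real n \<le> C * real n powr (- 3 / 2)" .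
    moreover have "0 \<le> nested x ks n * beta_prod x n / real n"
      using nested_nonneg[of x ks n] beta_prod_pos[of x n] x ks by simp
    ultimately show ?thesis
      by simp
  qed
  have "summable (\<lambda>n. C * real n powr (- 3 / 2))"
    by (intro summable_mult) (simp add: summable_real_powr_iff)
  then show ?thesis
    by (rule summable_comparison_test'[OF _ bound])
qed

text \<open>Expand the product defining \<open>block_gf\<close> and sum first over n at fixed p:
  with q = n - p this is the Beta series at p.\<close>

lemma block_gf_sums:
  assumes x: "0 \<le> x" "x \<le> 1 / 8" and ks: "ks \<noteq> []" "\<forall>k\<in>set ks. 1 \<le> k"
  shows "(\<lambda>n. block_gf x ks n / real n) sums (\<Sum>n. nested x ks n * beta_prod x n / real n)"
proof -
  let ?b = "\<lambda>p. nested x ks p * beta_prod x p / real p"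
  define a where "a p n = (if p \<le> n then nested x ks p * rising x $ (n - p) / real n else 0)" for p n
  have x1: "x < 1"
    using x by simp
  have "nested x ks 0 = 0"
    using ks(1) by (cases ks) auto
  have "a p sums ?b p" for p
  proof (cases p)
    case 0
    then have "a p = (\<lambda>_. 0)"
      using \<open>nested x ks 0 = 0\<close> by (auto simp: a_def fun_eq_iff)
    with 0 show ?thesis
      by simp
  next
    case (Suc p')
    have "(\<lambda>q. a p (q + p)) sums ?b p"
      using sums_mult[OF rising_beta_sums[OF x(1) x1, of p'], of "nested x ks p"]
      by (simp add: Suc a_def add.commute)
    moreover have "(\<Sum>i<p. a p i) = 0"
      by (intro sum.neutral) (auto simp: a_def)
    ultimately show ?thesis
      by (simp add: sums_iff_shift)
  qed
  moreover have "0 \<le> a p n" for p n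
    unfolding a_def using nested_nonneg[OF x(1) x1 ks(1)] rising_nonneg[OF x(1)] by simp
  moreover have "?b sums (\<Sum>n. ?b n)"
    using summable_nested_beta_prod[OF x ks] by (rule summable_sums)
  ultimately have "(\<lambda>n. \<Sum>p. a p n) sums (\<Sum>n. ?b n)"
    by (intro sums_swap_nonneg)
  moreover have "(\<Sum>p. a p n) = block_gf x ks n / real n" for n
  proof -
    have "(\<Sum>p. a p n) = (\<Sum>p\<in>{0..n}. a p n)"
      by (intro suminf_finite) (auto simp: a_def)
    also have "\<dots> = (\<Sum>p=0..n. nested x ks p * rising x $ (n - p)) / real n"
      unfolding sum_divide_distrib by (intro sum.cong) (auto simp: a_def)
    also have "\<dots> = (nested_fps x ks * rising x) $ n / real n"
      by (simp add: fps_mult_nth nested_fps_nth)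
    finally show ?thesis
      by (simp add: block_gf_def mult.commute)
  qed
  ultimately show ?thesis
    by simp
qed

section \<open>Multiple zeta values as series over the largest summation variable\<close>

definition mzv_below :: "nat \<Rightarrow> nat \<Rightarrow> nat list set" where
  "mzv_below n r = {ns \<in> mzv_domain r. \<forall>i\<in>set ns. i < n}"

lemma finite_mzv_below: "finite (mzv_below n r)"
  by (rule finite_subset[OF _ finite_lists_length_eq[of "{..<n}" r]])
     (auto simp: mzv_below_def mzv_domain_def)

lemma mzv_domain_Suc: "bij_betw (\<lambda>(n, ns). n # ns) (SIGMA n:{1..}. mzv_below n r) (mzv_domain (Suc r))"
  by (rule bij_betw_byWitness[where f' = "\<lambda>ns. (hd ns, tl ns)"])
     (auto simp: mzv_below_def mzv_domain_def length_Suc_conv)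

lemma mzv_below_Suc:
  "bij_betw (\<lambda>(m, ns). m # ns) (SIGMA m:{1..<n}. mzv_below m r) (mzv_below n (Suc r))"
  by (rule bij_betw_byWitness[where f' = "\<lambda>ns. (hd ns, tl ns)"])
     (fastforce simp: mzv_below_def mzv_domain_def length_Suc_conv)+

lemma sum_nested_0_eq_mzv_below:
  assumes "n > 0"
  shows "(\<Sum>m<n. nested 0 ks m) =
    (\<Sum>ns\<in>mzv_below n (length ks). \<Prod>i<length ks. 1 / real (ns ! i) ^ (ks ! i))"
  using assms
proof (induction ks arbitrary: n)
  case Nil
  have "mzv_below n 0 = {[]}"
    by (auto simp: mzv_below_def mzv_domain_def)
  moreover obtain m where "n = Suc m"
    using Nil by (cases n) auto
  ultimately show ?case
    using sum_nested_Nil[of 0 m] by (simp add: beta_prod_def pochhammer_fact[symmetric])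
next
  case (Cons k ks)
  let ?g = "\<lambda>ks ns. \<Prod>i<length ks. 1 / real (ns ! i) ^ (ks ! i)"
  have "(\<Sum>m<n. nested 0 (k # ks) m) = (\<Sum>m\<in>{1..<n}. nested 0 (k # ks) m)"
    by (rule sum.mono_neutral_right) (auto simp: Suc_le_eq)
  also have "\<dots> = (\<Sum>m\<in>{1..<n}. \<Sum>ns\<in>mzv_below m (length ks). ?g (k # ks) (m # ns))"
  proof (rule sum.cong)
    fix m assume "m \<in> {1..<n}"
    then show "nested 0 (k # ks) m = (\<Sum>ns\<in>mzv_below m (length ks). ?g (k # ks) (m # ns))"
      by (simp add: Cons.IH prod.lessThan_Suc_shift sum_divide_distrib del: prod.lessThan_Suc)
  qed simp
  also have "\<dots> = (\<Sum>(m, ns)\<in>(SIGMA m:{1..<n}. mzv_below m (length ks)). ?g (k # ks) (m # ns))"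
    by (rule sum.Sigma) (auto simp: finite_mzv_below)
  also have "\<dots> = (\<Sum>ns\<in>mzv_below n (Suc (length ks)). ?g (k # ks) ns)"
    by (subst sum.reindex_bij_betw[OF mzv_below_Suc, symmetric]) (simp add: case_prod_unfold)
  finally show ?case
    by simp
qed

text \<open>Groups the unordered sum by its largest variable n; by nonnegativity, summability of the
  group totals suffices.\<close>

lemma mzv_eq_suminf_nested:
  assumes "summable (nested 0 (k # ks))"
  shows "mzv (k # ks) = (\<Sum>n. nested 0 (k # ks) n)"
proof -
  let ?g = "\<lambda>ns. \<Prod>i<length (k # ks). 1 / real (ns ! i) ^ ((k # ks) ! i)"
  let ?h = "\<lambda>(n, ns). ?g (n # ns)"
  have rows: "((\<lambda>ns. ?h (n, ns)) has_sum nested 0 (k # ks) n) (mzv_below n (length ks))"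
    if "n \<in> {1..}" for n
    using that
    by (intro has_sum_finiteI finite_mzv_below)
       (simp add: sum_nested_0_eq_mzv_below prod.lessThan_Suc_shift sum_divide_distrib
         del: prod.lessThan_Suc)
  have "(nested 0 (k # ks) has_sum (\<Sum>n. nested 0 (k # ks) n)) UNIV"
    using assms by (intro sums_nonneg_imp_has_sum summable_sums nested_0_nonneg)
  then have total: "(nested 0 (k # ks) has_sum (\<Sum>n. nested 0 (k # ks) n)) {1..}"
    by (subst has_sum_cong_neutral[where T = UNIV and g = "nested 0 (k # ks)"])
       (auto simp: Suc_le_eq nested_Cons_0 simp del: nested.simps)
  have "?h summable_on (SIGMA n:{1..}. mzv_below n (length ks))"
    by (rule summable_on_SigmaI[OF rows])
       (use total in \<open>auto simp: summable_on_def simp del: nested.simps prod.lessThan_Suc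
          intro!: prod_nonneg\<close>)
  from has_sum_SigmaI[OF rows total this]
  have "(?h has_sum (\<Sum>n. nested 0 (k # ks) n)) (SIGMA n:{1..}. mzv_below n (length ks))" .
  moreover have "?h = (\<lambda>p. ?g ((\<lambda>(n, ns). n # ns) p))"
    by auto
  ultimately have "(?g has_sum (\<Sum>n. nested 0 (k # ks) n)) (mzv_domain (Suc (length ks)))"
    using has_sum_reindex_bij_betw[OF mzv_domain_Suc, of ?g] by simp
  then show ?thesis
    unfolding mzv_def by (simp add: infsumI)
qed

text \<open>Raising the first exponent divides the n-th term by n; convergence is the case x = 0 of
  \<open>summable_nested_beta_prod\<close>, where \<open>beta_prod\<close> is 1.\<close>

lemma mzv_plus_sums:
  assumes "ks \<noteq> []" "\<forall>k\<in>set ks. 1 \<le> k"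
  shows "(\<lambda>n. nested 0 ks n / real n) sums mzv_plus ks"
proof -
  obtain k ks' where ks: "ks = k # ks'"
    using assms(1) by (cases ks) auto
  have "beta_prod 0 n = 1" for n
    by (simp add: beta_prod_def pochhammer_fact[symmetric])
  then have "summable (\<lambda>n. nested 0 ks n / real n)"
    using summable_nested_beta_prod[OF _ _ assms, of 0] by simp
  moreover have "nested 0 ks n / real n = nested 0 ((k + 1) # ks') n" for n
    by (simp add: ks mult.commute)
  ultimately show ?thesis
    using mzv_eq_suminf_nested[of "k + 1" ks'] by (simp add: mzv_plus_def ks sums_iff del: nested.simps)
qed

section \<open>Comparison of coefficients\<close>

lemma block_sum_mzv_plus_sums:
  assumes "ks \<noteq> []"
  shows "(\<lambda>n. block_coeff ks n t / real n) sums block_sum ks t mzv_plus"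
proof -
  have "(\<lambda>n. nested 0 (concat as) n / real n) sums mzv_plus (concat as)"
    if "ms \<in> compositions (length ks) (length ks + t)" "as \<in> block_families ks ms" for ms as
  proof (rule mzv_plus_sums)
    have as: "length as = length ks"
      "\<And>i. i < length ks \<Longrightarrow> as ! i \<in> compositions (ms ! i) (ks ! i + ms ! i - 1)"
      using that(2) by (auto simp: block_families_def)
    have "1 \<le> ms ! 0" "as ! 0 \<in> set as"
      using that(1) assms as(1) by (auto simp: compositions_def)
    moreover from this have "as ! 0 \<noteq> []"
      using as(2)[of 0] assms by (auto simp: compositions_def)
    ultimately show "concat as \<noteq> []"
      by auto
    show "\<forall>k\<in>set (concat as). 1 \<le> k"
      using as by (auto simp: in_set_conv_nth[of _ as] compositions_def)
  qed
  then have "(\<lambda>n. block_sum ks t (\<lambda>w. nested 0 w n / real n)) sums block_sum ks t mzv_plus"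
    unfolding block_sum_eq[symmetric] by (intro sums_sum)
  then show ?thesis
    by (simp add: block_sum_divide)
qed

lemma insert_ones_pos:
  assumes "ks \<noteq> []" "\<forall>k\<in>set ks. 1 \<le> k" "k \<in> set (insert_ones ks ms)"
  shows "1 \<le> k"
  using assms by (auto simp: insert_ones_def in_set_butlastD dest!: set_zip_leftD)

lemma ohno_sum_mzv_plus_sums:
  assumes "ks \<noteq> []" "\<forall>k\<in>set ks. 1 \<le> k"
  shows "(\<lambda>n. ohno_coeff ks n t / real n) sums ohno_sum ks t mzv_plus"
proof -
  have "(\<lambda>n. nested 0 (map2 (+) (insert_ones ks ms) es) n / real n)
      sums mzv_plus (map2 (+) (insert_ones ks ms) es)"
    if "(ms, es) \<in> ohno_set ks t" for ms es
  proof (rule mzv_plus_sums)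
    show "map2 (+) (insert_ones ks ms) es \<noteq> []"
      using that insert_ones_nonempty[of ks ms] by (auto simp: ohno_set_def zip_eq_Nil_iff)
    show "\<forall>k\<in>set (map2 (+) (insert_ones ks ms) es). 1 \<le> k"
      using insert_ones_pos[OF assms, of _ ms] by (fastforce dest: set_zip_leftD)
  qed
  then show ?thesis
    unfolding ohno_sum_def sum_divide_distrib by (intro sums_sum) auto
qed

lemma block_sum_nonneg: "(\<And>w. 0 \<le> \<phi> w) \<Longrightarrow> 0 \<le> block_sum ks t \<phi>"
  by (induction ks arbitrary: t \<phi>) (auto intro!: sum_nonneg)

text \<open>Sums the double series in both orders: over t first it gives g, over n first the values
  z.\<close>

lemma coeff_series_sums:
  fixes c :: "nat \<Rightarrow> nat \<Rightarrow> real"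
  assumes "0 \<le> x" "\<And>n t. 0 \<le> c n t" "\<And>n. (\<lambda>t. c n t * x ^ t) sums g n"
    and "(\<lambda>n. g n / real n) sums S" "\<And>t. (\<lambda>n. c n t / real n) sums z t"
  shows "(\<lambda>t. z t * x ^ t) sums S"
proof -
  have "(\<lambda>t. \<Sum>n. c n t * x ^ t / real n) sums S"
    using assms by (intro sums_swap_nonneg[OF _ sums_divide[OF assms(3)] assms(4)]) auto
  moreover have "(\<Sum>n. c n t * x ^ t / real n) = z t * x ^ t" for t
    using sums_mult2[OF assms(5)[of t], of "x ^ t"] by (simp add: sums_iff)
  ultimately show ?thesis
    by simp
qed

text \<open>For 0 < x \<le> 1/8 the generating functions of both sides converge to the same
  \<open>?S\<close>, so all coefficients of the difference vanish.\<close>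

lemma block_sum_eq_ohno_sum:
  assumes ks: "ks \<noteq> []" "\<forall>k\<in>set ks. 1 \<le> k"
  shows "block_sum ks t mzv_plus = ohno_sum ks t mzv_plus"
proof -
  have "(\<lambda>t. (block_sum ks t mzv_plus - ohno_sum ks t mzv_plus) * x ^ t) sums 0"
    if x: "0 < x" "x \<le> 1 / 8" for x
  proof -
    have x': "0 \<le> x" "x < 1"
      using x by auto
    let ?S = "\<Sum>n. nested x ks n * beta_prod x n / real n"
    have "(\<lambda>t. block_sum ks t mzv_plus * x ^ t) sums ?S"
      using ks x' x(2)
      by (intro coeff_series_sums[OF _ _ block_coeff_sums block_gf_sums block_sum_mzv_plus_sums]
          block_sum_nonneg nested_0_nonneg)
    moreover have "(\<lambda>t. ohno_sum ks t mzv_plus * x ^ t) sums ?S"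
      using ks x' x(2)
      by (intro coeff_series_sums[OF _ _ ohno_coeff_sums _ ohno_sum_mzv_plus_sums]
          ohno_sum_nonneg nested_0_nonneg summable_sums summable_nested_beta_prod)
    ultimately show ?thesis
      using sums_diff by (fastforce simp: left_diff_distrib)
  qed
  from power_series_coeff_zero[OF _ this, of "1 / 8" t] show ?thesis
    by simp
qed

theorem theorem1p1:
  fixes r t :: nat and ks :: "nat list"
  assumes "r \<ge> 1" and "length ks = r" and "\<forall>k\<in>set ks. 1 \<le> k"
  shows "(\<Sum>ms\<in>compositions r (r + t). \<Sum>as\<in>block_families ks ms. mzv_plus (concat as))
       = (\<Sum>l=0..t. \<Sum>ms\<in>weak_compositions (r - 1) (t - l).
            \<Sum>es\<in>weak_compositions (length (insert_ones ks ms)) l.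
              mzv_plus (map2 (+) (insert_ones ks ms) es))"
proof -
  have "ks \<noteq> []"
    using assms by auto
  then show ?thesis
    using block_sum_eq_ohno_sum[of ks t] assms
    by (simp add: block_sum_eq[where \<phi> = mzv_plus, symmetric] ohno_sum_eq[where \<phi> = mzv_plus, symmetric])
qed

end
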